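(* Let $I$ be a set and let $\|\cdot\|\colon 2^{(I)}\to[0,\infty)$ be an injective map satisfying $\|\emptyset\|=0$ and $\|x\mathbin{\triangle}y\|\le\|x\|+\|y\|$ for all $x,y\in 2^{(I)}$. Then putting $d(x,y):=\|x\mathbin{\triangle}y\|$ for $x,y\in 2^{(I)}$ turns $2^{(I)}$ into a homogeneous isosceles-free metric space. Moreover, every nonempty homogeneous isosceles-free metric space is isometric to one obtained this way (for some set $I$ and some such map $\|\cdot\|$).
   Context: $2^{(I)}$ denotes the family of all finite subsets of $I$, which is a Boolean group under the symmetric difference $x\mathbin{\triangle}y=(x\setminus y)\cup(y\setminus x)$. A metric space $X$ is isosceles-free if $d(x,y)\neq d(x,z)$ for all pairwise distinct $x,y,z\in X$. A metric space $X$ is $1$-homogeneous if for all $x,y\in X$ there is a bijective isometry $F\colon X\to X$ with $F(x)=y$. A homogeneous isosceles-free space is a metric space that is both $1$-homogeneous and isosceles-free. *)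

theory Defs
  imports "HOL-Analysis.Abstract_Metric_Spaces" "HOL-Library.FuncSet"
begin

definition isometry_between ::
  "'a set \<Rightarrow> ('a \<Rightarrow> 'a \<Rightarrow> real) \<Rightarrow> 'b set \<Rightarrow> ('b \<Rightarrow> 'b \<Rightarrow> real) \<Rightarrow> ('a \<Rightarrow> 'b) \<Rightarrow> bool" where
  "isometry_between X d Y e f \<longleftrightarrow>
     bij_betw f X Y \<and> (\<forall>x\<in>X. \<forall>y\<in>X. e (f x) (f y) = d x y)"

definition isometric_spaces ::
  "'a set \<Rightarrow> ('a \<Rightarrow> 'a \<Rightarrow> real) \<Rightarrow> 'b set \<Rightarrow> ('b \<Rightarrow> 'b \<Rightarrow> real) \<Rightarrow> bool" where
  "isometric_spaces X d Y e \<longleftrightarrow> (\<exists>f. isometry_between X d Y e f)"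

definition isosceles_free :: "'a set \<Rightarrow> ('a \<Rightarrow> 'a \<Rightarrow> real) \<Rightarrow> bool" where
  "isosceles_free X d \<longleftrightarrow>
     (\<forall>x\<in>X. \<forall>y\<in>X. \<forall>z\<in>X. x \<noteq> y \<and> y \<noteq> z \<and> x \<noteq> z \<longrightarrow> d x y \<noteq> d x z)"

definition one_homogeneous :: "'a set \<Rightarrow> ('a \<Rightarrow> 'a \<Rightarrow> real) \<Rightarrow> bool" where
  "one_homogeneous X d \<longleftrightarrow>
     (\<forall>x\<in>X. \<forall>y\<in>X. \<exists>F. isometry_between X d X d F \<and> F x = y)"

definition homogeneous_isosceles_free_space :: "'a set \<Rightarrow> ('a \<Rightarrow> 'a \<Rightarrow> real) \<Rightarrow> bool" where
  "homogeneous_isosceles_free_space X d \<longleftrightarrow>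
     Metric_space X d \<and> one_homogeneous X d \<and> isosceles_free X d"

definition injective_finset_norm :: "'a set \<Rightarrow> ('a set \<Rightarrow> real) \<Rightarrow> bool" where
  "injective_finset_norm I nrm \<longleftrightarrow>
     nrm \<in> Fpow I \<rightarrow> {0..} \<and> inj_on nrm (Fpow I) \<and> nrm {} = 0 \<and>
     (\<forall>x\<in>Fpow I. \<forall>y\<in>Fpow I. nrm (sym_diff x y) \<le> nrm x + nrm y)"

text \<open>The locale \<^locale>\<open>Metric_space\<close> requires nonnegativity and symmetry of the distance
  function on the whole type, while \<open>nrm\<close> is only constrained on \<open>Fpow I\<close>. Hence the distance
  is set to \<open>0\<close> off the carrier.\<close>

definition finset_dist :: "'a set \<Rightarrow> ('a set \<Rightarrow> real) \<Rightarrow> 'a set \<Rightarrow> 'a set \<Rightarrow> real" where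
  "finset_dist I nrm x y = (if x \<in> Fpow I \<and> y \<in> Fpow I then nrm (sym_diff x y) else 0)"

end

theory Submission
  imports Defs "HOL-Algebra.FiniteProduct"
begin

text \<open>
  That a norm yields a homogeneous isosceles-free space rests on the translations
  \<open>z \<mapsto> z \<triangle> a\<close>: they preserve the distance and act transitively, and the distances from a fixed
  point \<open>x\<close> are the norms of the pairwise distinct sets \<open>x \<triangle> y\<close>.

  For the converse, isosceles-freeness says that a point is determined by its distance from any
  one given point. Hence an isometry is determined by the image of a single point
  (\<open>isosceles_free_isometry_unique\<close>), and every isometry is an involution, because \<open>x\<close> and
  \<open>F (F x)\<close> are equally far from \<open>F x\<close> (\<open>isosceles_free_isometry_involution\<close>). So the isometries
  act simply transitively, and after the choice of a base point \<open>o\<close> the space itself becomes a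
  group of exponent two, in which \<open>d x y = d o (x \<otimes> y)\<close>. Such a group is a vector space over the
  field with two elements. A basis \<open>B\<close>, obtained from Zorn's lemma, identifies the group with the
  finite subsets of \<open>B\<close> under symmetric difference, and \<open>S \<mapsto> d o (\<Otimes>x\<in>S. x)\<close> is the required norm.
\<close>

section \<open>Finite sets with an injective norm\<close>

lemma sym_diff_in_Fpow:
  "x \<in> Fpow I \<Longrightarrow> y \<in> Fpow I \<Longrightarrow> sym_diff x y \<in> Fpow I"
  by (auto simp: Fpow_def)

lemma finset_dist_eq [simp]:
  "x \<in> Fpow I \<Longrightarrow> y \<in> Fpow I \<Longrightarrow> finset_dist I nrm x y = nrm (sym_diff x y)"
  by (simp add: finset_dist_def)

lemma Metric_space_finset_dist:
  assumes "injective_finset_norm I nrm"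
  shows "Metric_space (Fpow I) (finset_dist I nrm)"
proof
  have nonneg: "nrm x \<ge> 0" if "x \<in> Fpow I" for x
    using assms that by (auto simp: injective_finset_norm_def)
  have empty: "{} \<in> Fpow I"
    by (simp add: Fpow_def)
  show "0 \<le> finset_dist I nrm x y" for x y
    using nonneg sym_diff_in_Fpow[of x I y] by (simp add: finset_dist_def)
  show "finset_dist I nrm x y = finset_dist I nrm y x" for x y
    by (simp add: finset_dist_def Un_commute)
  show "finset_dist I nrm x y = 0 \<longleftrightarrow> x = y" if "x \<in> Fpow I" "y \<in> Fpow I" for x y
  proof
    assume "finset_dist I nrm x y = 0"
    then have "nrm (sym_diff x y) = nrm {}"
      using assms that by (simp add: injective_finset_norm_def)
    then have "sym_diff x y = {}"
      using assms empty sym_diff_in_Fpow[OF that]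
      unfolding injective_finset_norm_def inj_on_def by blast
    then show "x = y" by blast
  next
    assume "x = y"
    then show "finset_dist I nrm x y = 0"
      using assms that by (simp add: injective_finset_norm_def)
  qed
  show "finset_dist I nrm x z \<le> finset_dist I nrm x y + finset_dist I nrm y z"
    if "x \<in> Fpow I" "y \<in> Fpow I" "z \<in> Fpow I" for x y z
  proof -
    have "sym_diff x z = sym_diff (sym_diff x y) (sym_diff y z)" by blast
    moreover have "nrm (sym_diff (sym_diff x y) (sym_diff y z))
        \<le> nrm (sym_diff x y) + nrm (sym_diff y z)"
      using assms sym_diff_in_Fpow[OF that(1,2)] sym_diff_in_Fpow[OF that(2,3)]
      unfolding injective_finset_norm_def by blast
    ultimately show ?thesis using that by simp
  qed
qed

lemma isometry_between_translation:
  assumes "a \<in> Fpow I"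
  shows "isometry_between (Fpow I) (finset_dist I nrm) (Fpow I) (finset_dist I nrm)
           (\<lambda>z. sym_diff z a)"
proof -
  have "bij_betw (\<lambda>z. sym_diff z a) (Fpow I) (Fpow I)"
  proof (rule bij_betwI[where g = "\<lambda>z. sym_diff z a"])
    show "(\<lambda>z. sym_diff z a) \<in> Fpow I \<rightarrow> Fpow I" "(\<lambda>z. sym_diff z a) \<in> Fpow I \<rightarrow> Fpow I"
      using assms sym_diff_in_Fpow by blast+
  qed blast+
  moreover have "sym_diff (sym_diff x a) (sym_diff y a) = sym_diff x y" for x y
    by blast
  ultimately show ?thesis
    using assms by (simp add: isometry_between_def sym_diff_in_Fpow)
qed

lemma homogeneous_isosceles_free_finset_space:
  assumes "injective_finset_norm I nrm"
  shows "homogeneous_isosceles_free_space (Fpow I) (finset_dist I nrm)"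
proof -
  have "one_homogeneous (Fpow I) (finset_dist I nrm)"
    unfolding one_homogeneous_def
  proof (intro ballI)
    fix x y assume xy: "x \<in> Fpow I" "y \<in> Fpow I"
    have "isometry_between (Fpow I) (finset_dist I nrm) (Fpow I) (finset_dist I nrm)
            (\<lambda>z. sym_diff z (sym_diff x y))"
      using xy by (intro isometry_between_translation sym_diff_in_Fpow)
    moreover have "sym_diff x (sym_diff x y) = y" by blast
    ultimately show "\<exists>F. isometry_between (Fpow I) (finset_dist I nrm)
        (Fpow I) (finset_dist I nrm) F \<and> F x = y"
      by (intro exI[of _ "\<lambda>z. sym_diff z (sym_diff x y)"] conjI)
  qed
  moreover have "isosceles_free (Fpow I) (finset_dist I nrm)"
    unfolding isosceles_free_def
  proof (intro ballI impI notI)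
    fix x y z
    assume mem: "x \<in> Fpow I" "y \<in> Fpow I" "z \<in> Fpow I"
      and ne: "x \<noteq> y \<and> y \<noteq> z \<and> x \<noteq> z"
      and eq: "finset_dist I nrm x y = finset_dist I nrm x z"
    have "sym_diff x y = sym_diff x z"
      using assms eq mem sym_diff_in_Fpow[OF mem(1,2)] sym_diff_in_Fpow[OF mem(1,3)]
      by (auto simp: injective_finset_norm_def dest: inj_onD)
    then have "y = z" by blast
    then show False using ne by blast
  qed
  ultimately show ?thesis
    using Metric_space_finset_dist[OF assms]
    by (simp add: homogeneous_isosceles_free_space_def)
qed

section \<open>Bases of groups of exponent two\<close>

locale boolean_group = group +
  assumes square_eq_one: "x \<in> carrier G \<Longrightarrow> x \<otimes> x = \<one>"
begin

lemma inv_eq_self: "x \<in> carrier G \<Longrightarrow> inv x = x"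
  by (simp add: inv_equality square_eq_one)

text \<open>Inversion reverses products, and here every element is its own inverse.\<close>

sublocale comm_group
proof (rule group_comm_groupI)
  fix x y assume "x \<in> carrier G" "y \<in> carrier G"
  then show "x \<otimes> y = y \<otimes> x"
    by (metis inv_eq_self inv_mult_group m_closed)
qed

lemma finprod_sym_diff:
  assumes "finite S" "finite T" "S \<subseteq> carrier G" "T \<subseteq> carrier G"
  shows "(\<Otimes>x\<in>sym_diff S T. x) = (\<Otimes>x\<in>S. x) \<otimes> (\<Otimes>x\<in>T. x)"
proof -
  define p where "p A = (\<Otimes>x\<in>A. x)" for A
  have cl: "p A \<in> carrier G" if "A \<subseteq> carrier G" for A
    using that unfolding p_def by (intro finprod_closed) auto
  have un: "p (A \<union> B) = p A \<otimes> p B"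
    if "finite A" "finite B" "A \<inter> B = {}" "A \<subseteq> carrier G" "B \<subseteq> carrier G" for A B
    using that unfolding p_def by (intro finprod_Un_disjoint) auto
  let ?a = "p (S - T)" and ?b = "p (T - S)" and ?c = "p (S \<inter> T)"
  have mem: "?a \<in> carrier G" "?b \<in> carrier G" "?c \<in> carrier G"
    using assms by (auto intro!: cl)
  have "p S = ?a \<otimes> ?c"
    using un[of "S - T" "S \<inter> T"] assms by (auto simp: Un_Diff_Int Int_Diff)
  moreover have "p T = ?c \<otimes> ?b"
    using un[of "S \<inter> T" "T - S"] assms
    by (metis Diff_disjoint Int_commute Int_Diff_disjoint Int_Diff_Un finite_Diff finite_Int
        le_infI1 Diff_subset subset_trans)
  moreover have "p (sym_diff S T) = ?a \<otimes> ?b"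
    using un[of "S - T" "T - S"] assms by blast
  moreover have "(?a \<otimes> ?c) \<otimes> (?c \<otimes> ?b) = ?a \<otimes> ((?c \<otimes> ?c) \<otimes> ?b)"
    using mem by (simp add: m_assoc)
  ultimately show ?thesis
    using mem square_eq_one by (simp add: p_def)
qed

text \<open>This is linear independence over the field with two elements: a linear combination amounts
  to the choice of a finite subset.\<close>

definition independent :: "'a set \<Rightarrow> bool" where
  "independent B \<longleftrightarrow> B \<subseteq> carrier G \<and> (\<forall>S\<in>Fpow B. (\<Otimes>x\<in>S. x) = \<one> \<longrightarrow> S = {})"

text \<open>Independence is a property of finite character, so Zorn's lemma applies.\<close>

lemma maximal_independent_exists:
  "\<exists>B. independent B \<and> (\<forall>C. independent C \<longrightarrow> B \<subseteq> C \<longrightarrow> C = B)"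
proof -
  have "\<exists>B\<in>Collect independent. \<forall>C\<in>Collect independent. B \<subseteq> C \<longrightarrow> C = B"
  proof (rule subset_Zorn)
    fix \<C> assume chain: "subset.chain (Collect independent) \<C>"
    show "\<exists>U\<in>Collect independent. \<forall>C\<in>\<C>. C \<subseteq> U"
    proof (cases "\<C> = {}")
      case True
      have "independent {}"
        by (auto simp: independent_def Fpow_def)
      then show ?thesis using True by blast
    next
      case False
      have "independent (\<Union>\<C>)"
        unfolding independent_def
      proof (intro conjI ballI impI)
        show "\<Union>\<C> \<subseteq> carrier G"
          using chain unfolding subset_chain_def independent_def by blast
        fix S assume S: "S \<in> Fpow (\<Union>\<C>)" and one: "(\<Otimes>x\<in>S. x) = \<one>"
        have "finite S" "S \<subseteq> \<Union>\<C>" using S by (auto simp: Fpow_def)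
        then obtain C where "C \<in> \<C>" "S \<subseteq> C"
          using finite_subset_Union_chain[OF _ _ False chain] by metis
        moreover have "independent C"
          using chain \<open>C \<in> \<C>\<close> by (auto simp: subset_chain_def)
        ultimately show "S = {}"
          using one \<open>finite S\<close> unfolding independent_def Fpow_def by blast
      qed
      then show ?thesis by blast
    qed
  qed
  then show ?thesis by auto
qed

lemma basis_exists:
  "\<exists>B \<subseteq> carrier G. bij_betw (\<lambda>S. \<Otimes>x\<in>S. x) (Fpow B) (carrier G)"
proof -
  obtain B where B: "independent B" and max: "\<And>C. independent C \<Longrightarrow> B \<subseteq> C \<Longrightarrow> C = B"
    using maximal_independent_exists by blast
  have sub: "B \<subseteq> carrier G" using B by (simp add: independent_def)
  have Fp: "finite S \<and> S \<subseteq> carrier G" if "S \<in> Fpow B" for S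
    using that sub by (auto simp: Fpow_def)
  have inj: "inj_on (\<lambda>S. \<Otimes>x\<in>S. x) (Fpow B)"
  proof (rule inj_onI)
    fix S T assume ST: "S \<in> Fpow B" "T \<in> Fpow B" and eq: "(\<Otimes>x\<in>S. x) = (\<Otimes>x\<in>T. x)"
    have "(\<Otimes>x\<in>T. x) \<in> carrier G"
      using Fp[OF ST(2)] by (intro finprod_closed) auto
    then have "(\<Otimes>x\<in>sym_diff S T. x) = \<one>"
      using finprod_sym_diff[of S T] Fp[OF ST(1)] Fp[OF ST(2)] eq square_eq_one by simp
    then have "sym_diff S T = {}"
      using B sym_diff_in_Fpow[OF ST] unfolding independent_def by blast
    then show "S = T" by blast
  qed
  have surj: "\<exists>S\<in>Fpow B. v = (\<Otimes>x\<in>S. x)" if v: "v \<in> carrier G" for v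
  proof (cases "v \<in> B")
    case True
    have "(\<Otimes>x\<in>{v}. x) = v" using v by simp
    moreover have "{v} \<in> Fpow B" using True by (simp add: Fpow_def)
    ultimately show ?thesis by metis
  next
    case False
    then have "\<not> independent (insert v B)" using max[of "insert v B"] by blast
    then obtain S where S: "finite S" "S \<subseteq> insert v B" "S \<noteq> {}" and one: "(\<Otimes>x\<in>S. x) = \<one>"
      using v sub by (auto simp: independent_def Fpow_def)
    \<comment> \<open>The relation must involve \<open>v\<close>, as \<open>B\<close> admits none, so it can be solved for \<open>v\<close>.\<close>
    have "v \<in> S"
      using S one B unfolding independent_def Fpow_def by blast
    let ?T = "S - {v}"
    have T: "finite ?T" "?T \<subseteq> B" "?T \<subseteq> carrier G" using S sub by auto
    have Tc: "(\<Otimes>x\<in>?T. x) \<in> carrier G"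
      using T(3) by (intro finprod_closed) auto
    have "(\<Otimes>x\<in>insert v ?T. x) = v \<otimes> (\<Otimes>x\<in>?T. x)"
      using T v by (intro finprod_insert) auto
    then have "v \<otimes> (\<Otimes>x\<in>?T. x) = \<one>"
      using one \<open>v \<in> S\<close> by (simp add: insert_absorb)
    then have "v = (\<Otimes>x\<in>?T. x)"
      using Tc v inv_equality inv_eq_self by metis
    then show ?thesis using T(1,2) by (auto simp: Fpow_def)
  qed
  have "(\<Otimes>x\<in>S. x) \<in> carrier G" if "S \<in> Fpow B" for S
    using Fp[OF that] by (intro finprod_closed) auto
  then have "(\<lambda>S. \<Otimes>x\<in>S. x) ` Fpow B = carrier G" using surj by blast
  then show ?thesis using inj sub by (auto simp: bij_betw_def)
qed

end

section \<open>Isometries of isosceles-free spaces\<close>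

lemma isometry_between_id: "isometry_between X d X d (\<lambda>x. x)"
  by (simp add: isometry_between_def bij_betw_def)

lemma isometry_between_comp:
  assumes "isometry_between X d Y e F" "isometry_between Y e Z c H"
  shows "isometry_between X d Z c (\<lambda>x. H (F x))"
  using assms bij_betw_trans[of F X Y H Z] bij_betwE[of F X Y]
  by (auto simp: isometry_between_def comp_def)

lemma isometry_between_inv_into:
  assumes "isometry_between X d Y e F"
  shows "isometry_between Y e X d (inv_into X F)"
proof -
  have bij: "bij_betw F X Y" using assms by (simp add: isometry_between_def)
  have "d (inv_into X F x) (inv_into X F y) = e x y" if "x \<in> Y" "y \<in> Y" for x y
    using assms that bij_betw_inv_into_right[OF bij] bij_betwE[OF bij_betw_inv_into[OF bij]]
    unfolding isometry_between_def by metis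
  then show ?thesis
    using bij_betw_inv_into[OF bij] by (simp add: isometry_between_def)
qed

text \<open>Given \<open>F x = H x\<close>, the points \<open>F y\<close> and \<open>H y\<close> both have distance \<open>d x y\<close> from this common
  image, so they coincide.\<close>

lemma isosceles_free_isometry_unique:
  assumes free: "isosceles_free Y e"
    and F: "isometry_between X d Y e F" and H: "isometry_between X d Y e H"
    and x: "x \<in> X" and y: "y \<in> X" and eq: "F x = H x"
  shows "F y = H y"
proof (cases "x = y")
  case False
  have "F x \<noteq> F y" "H x \<noteq> H y"
    using F H x y False by (auto simp: isometry_between_def bij_betw_def dest: inj_onD)
  moreover have "e (F x) (F y) = e (F x) (H y)"
    using F H x y eq by (metis isometry_between_def)
  moreover have "F x \<in> Y" "F y \<in> Y" "H y \<in> Y"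
    using F H x y by (auto simp: isometry_between_def bij_betw_def)
  ultimately show ?thesis
    using free eq unfolding isosceles_free_def by metis
qed (use eq in simp)

lemma isosceles_free_isometry_involution:
  assumes "Metric_space X d" and free: "isosceles_free X d"
    and F: "isometry_between X d X d F" and x: "x \<in> X"
  shows "F (F x) = x"
proof (cases "F x = x")
  case False
  have mem: "F x \<in> X" "F (F x) \<in> X"
    using F x by (auto simp: isometry_between_def dest: bij_betwE)
  then have "F (F x) \<noteq> F x"
    using F x False by (auto simp: isometry_between_def bij_betw_def dest: inj_onD)
  moreover have "d (F x) (F (F x)) = d (F x) x"
    using F x mem Metric_space.commute[OF assms(1)] by (metis isometry_between_def)
  ultimately show ?thesis
    using free mem x False unfolding isosceles_free_def by metis
qed simp

lemma isosceles_free_inj_dist: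
  assumes "Metric_space X d" and "isosceles_free X d" and "x \<in> X"
  shows "inj_on (d x) X"
proof (rule inj_onI, rule ccontr)
  fix y z assume yz: "y \<in> X" "z \<in> X" "d x y = d x z" "y \<noteq> z"
  have "x \<noteq> y" "x \<noteq> z"
    using yz assms Metric_space.zero[OF assms(1)] by metis+
  then show False
    using yz assms(2,3) unfolding isosceles_free_def by blast
qed

section \<open>The group structure on the space\<close>

text \<open>The product \<open>x \<otimes> y\<close> is the image of \<open>y\<close> under the unique isometry that moves the base point
  to \<open>x\<close>. This transports composition of isometries to the points of the space.\<close>

lemma homogeneous_isosceles_free_boolean_group:
  fixes X :: "'a set"
  assumes X: "homogeneous_isosceles_free_space X d" and p: "p \<in> X"
  shows "\<exists>G :: 'a monoid. boolean_group G \<and> carrier G = X \<and> \<one>\<^bsub>G\<^esub> = p \<and>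
             (\<forall>x\<in>X. \<forall>y\<in>X. d p (x \<otimes>\<^bsub>G\<^esub> y) = d x y)"
proof -
  have M: "Metric_space X d" and free: "isosceles_free X d"
    and hom: "one_homogeneous X d"
    using X by (simp_all add: homogeneous_isosceles_free_space_def)
  have "\<exists>T. \<forall>x\<in>X. isometry_between X d X d (T x) \<and> T x p = x"
    using hom p unfolding one_homogeneous_def by (intro bchoice) blast
  then obtain T where iso: "\<And>x. x \<in> X \<Longrightarrow> isometry_between X d X d (T x)"
    and Tp: "\<And>x. x \<in> X \<Longrightarrow> T x p = x" by blast
  have cl: "T x y \<in> X" if "x \<in> X" "y \<in> X" for x y
    using iso[OF that(1)] that(2) by (auto simp: isometry_between_def bij_betw_def)
  have one: "T p y = y" if "y \<in> X" for y
    using isosceles_free_isometry_unique[OF free iso[OF p] isometry_between_id p that] Tp p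
    by simp
  have assoc: "T (T x y) z = T x (T y z)" if "x \<in> X" "y \<in> X" "z \<in> X" for x y z
    using isosceles_free_isometry_unique[OF free iso[OF cl[OF that(1,2)]]
        isometry_between_comp[OF iso[OF that(2)] iso[OF that(1)]] p that(3)]
      Tp that cl by simp
  have sq: "T x x = p" if "x \<in> X" for x
    using isosceles_free_isometry_involution[OF M free iso[OF that] p] Tp that by simp
  define G where "G = \<lparr>carrier = X, mult = T, one = p\<rparr>"
  interpret group G
  proof (rule groupI)
    show "\<exists>y\<in>carrier G. y \<otimes>\<^bsub>G\<^esub> x = \<one>\<^bsub>G\<^esub>" if "x \<in> carrier G" for x
      using that sq by (intro bexI[of _ x]) (simp_all add: G_def)
  qed (use p cl one assoc in \<open>simp_all add: G_def\<close>)
  have "boolean_group G"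
    by unfold_locales (simp add: G_def sq)
  \<comment> \<open>\<open>T x\<close> is an involution with \<open>T x p = x\<close>, so it moves the pair \<open>x\<close>, \<open>y\<close> to \<open>p\<close>, \<open>T x y\<close>.\<close>
  moreover have "d p (T x y) = d x y" if "x \<in> X" "y \<in> X" for x y
    using iso[OF that(1)] sq that unfolding isometry_between_def by metis
  ultimately show ?thesis
    by (auto simp: G_def intro!: exI[of _ G])
qed

lemma homogeneous_isosceles_free_isometric_finset_space:
  fixes X :: "'b set"
  assumes X: "homogeneous_isosceles_free_space X d" and "X \<noteq> {}"
  shows "\<exists>(I :: 'b set) nrm.
           injective_finset_norm I nrm \<and> isometric_spaces X d (Fpow I) (finset_dist I nrm)"
proof -
  obtain p where p: "p \<in> X" using \<open>X \<noteq> {}\<close> by blast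
  obtain G :: "'b monoid" where G: "boolean_group G" and carr: "carrier G = X" and one: "\<one>\<^bsub>G\<^esub> = p"
    and dist: "\<And>x y. x \<in> X \<Longrightarrow> y \<in> X \<Longrightarrow> d p (x \<otimes>\<^bsub>G\<^esub> y) = d x y"
    using homogeneous_isosceles_free_boolean_group[OF X p] by blast
  have M: "Metric_space X d" and free: "isosceles_free X d"
    using X by (simp_all add: homogeneous_isosceles_free_space_def)
  interpret boolean_group G by (fact G)
  interpret M: Metric_space X d by (fact M)
  define f where "f S = (\<Otimes>\<^bsub>G\<^esub>x\<in>S. x)" for S
  obtain B where B: "B \<subseteq> X" and bij: "bij_betw f (Fpow B) X"
    using basis_exists carr unfolding f_def by blast
  define nrm where "nrm S = d p (f S)" for S
  have fX: "f S \<in> X" if "S \<in> Fpow B" for S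
    using bij that by (rule bij_betw_apply)
  have nrm_eq: "nrm (sym_diff S T) = d (f S) (f T)" if "S \<in> Fpow B" "T \<in> Fpow B" for S T
  proof -
    have "f (sym_diff S T) = f S \<otimes>\<^bsub>G\<^esub> f T"
      unfolding f_def using that B carr by (intro finprod_sym_diff) (auto simp: Fpow_def)
    then show ?thesis using dist fX that by (simp add: nrm_def)
  qed
  have "injective_finset_norm B nrm"
    unfolding injective_finset_norm_def
  proof (intro conjI ballI)
    show "nrm \<in> Fpow B \<rightarrow> {0..}" by (simp add: nrm_def)
    have "inj_on (d p \<circ> f) (Fpow B)"
      using bij isosceles_free_inj_dist[OF M free p]
      by (auto simp: bij_betw_def intro: comp_inj_on)
    then show "inj_on nrm (Fpow B)" by (simp add: nrm_def[abs_def] comp_def)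
    show "nrm {} = 0" using p by (simp add: nrm_def f_def one)
    fix S T assume ST: "S \<in> Fpow B" "T \<in> Fpow B"
    have "d (f S) (f T) \<le> d (f S) p + d p (f T)"
      using M.triangle fX ST p by blast
    then show "nrm (sym_diff S T) \<le> nrm S + nrm T"
      using nrm_eq[OF ST] by (simp add: nrm_def M.commute)
  qed
  moreover have "isometry_between (Fpow B) (finset_dist B nrm) X d f"
    using bij nrm_eq by (simp add: isometry_between_def)
  then have "isometric_spaces X d (Fpow B) (finset_dist B nrm)"
    using isometry_between_inv_into unfolding isometric_spaces_def by blast
  ultimately show ?thesis by blast
qed

theorem theorem4p9:
  shows "(\<forall>(I :: 'a set) (nrm :: 'a set \<Rightarrow> real).
            injective_finset_norm I nrm \<longrightarrow>
            homogeneous_isosceles_free_space (Fpow I) (finset_dist I nrm))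
       \<and> (\<forall>(X :: 'b set) (d :: 'b \<Rightarrow> 'b \<Rightarrow> real).
            X \<noteq> {} \<and> homogeneous_isosceles_free_space X d \<longrightarrow>
            (\<exists>(I :: 'b set) (nrm :: 'b set \<Rightarrow> real).
               injective_finset_norm I nrm \<and>
               isometric_spaces X d (Fpow I) (finset_dist I nrm)))"
  using homogeneous_isosceles_free_finset_space
    homogeneous_isosceles_free_isometric_finset_space by blast

end
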